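(* Assume a $C^2$ function $h:\mathcal{D}\times\mathbb{R}_{\ge 0}\to\mathbb{R}$ has relative degree two with respect to the uncertain closed loop $$\dot x(t)=f(x(t))+g(x(t))\,(u(t)+w(t)),\qquad u(t)=k(x(t),r(t)),\qquad w(t)=\phi(u(t),t),$$ and satisfies, for some $\alpha>0$ and all $(x,t)\in\mathcal{D}\times\mathbb{R}_{\ge 0}$, $$\sup_{u\in\mathcal{U}}\big[\bar L_f^2h(x,t)+L_g\bar L_fh(x,t)\,(u+w^*(u))\big]\ \ge\ -2\alpha\,\bar L_fh(x,t)-\alpha^2h(x,t),$$ where $$w^*(u)=-\theta\|u\|_2\,\frac{L_g\bar L_fh(x,t)^\top}{\|L_g\bar L_fh(x,t)\|_2}.$$ Then any controller $k:\mathcal{D}\times\mathcal{R}\to\mathcal{U}$ that is Lipschitz continuous in $x$ and $r$ and satisfies $k(x,r)\in\mathcal{U}_{\mathrm{RTVCBF}}(x,t)$ for all $(x,r,t)\in\mathcal{D}\times\mathcal{R}\times\mathbb{R}_{\ge 0}$, where $$\mathcal{U}_{\mathrm{RTVCBF}}(x,t)=\{u\in\mathcal{U}:\ \bar L_f^2h(x,t)+2\alpha\bar L_fh(x,t)+\alpha^2h(x,t)+L_g\bar L_fh(x,t)\,(u+w^*(u))\ge 0\},$$ renders the set $\mathcal{C}(t)=\{x\in\mathcal{D}: h(x,t)\ge 0\}$ robust time-varying forward invariant provided that $x(0)=x_0\in\mathcal{C}(0)\cap\mathcal{C}_1(0)$, where $\mathcal{C}_1(t)=\{x\in\mathcal{D}:\bar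 L_fh(x,t)+\alpha h(x,t)\ge 0\}$. That is, for all admissible nonlinearities $\phi$ in the sector $[-\theta,\theta]$, if $x_0\in\mathcal{C}(0)\cap\mathcal{C}_1(0)$ then $x(t)\in\mathcal{C}(t)$ for all $t\ge 0$ along the closed loop.
   Context: Setting: $\mathcal{D}\subseteq\mathbb{R}^n$ is the set of admissible states, $\mathcal{U}\subseteq\mathbb{R}^m$ the set of admissible inputs, and $\mathcal{R}$ (a subset of a Euclidean space) the set of admissible values of the reference signal $r(t)\in\mathcal{R}$. The functions $f:\mathcal{D}\to\mathbb{R}^n$ and $g:\mathcal{D}\to\mathbb{R}^{n\times m}$ are locally Lipschitz continuous. A real number $\theta$ with $0<\theta<1$ is fixed. Admissible nonlinearity in the sector $[-\theta,\theta]$: a memoryless, possibly time-varying map $\phi:\mathcal{U}\times\mathbb{R}_{\ge 0}\to\mathbb{R}^m$ whose input $u(t)$ and output $w(t)=\phi(u(t),t)$ satisfy $\|w(t)\|_2\le\theta\|u(t)\|_2$ for all $t\ge 0$. Modified Lie derivatives: $L_f h=\frac{\partial h}{\partial x}f$, $L_g h=\frac{\partial h}{\partial x}g$ (a row vector in $\mathbb{R}^{1\times m}$), and $\bar L_f^i h=\left(\frac{\partial}{\partial t}+L_f\right)^i h$ for nonnegative integers $i$; thus $\bar L_f h=\frac{\partial h}{\partial t}+\frac{\partial h}{\partial x}f$, $\bar L_f^2h=\bar L_f(\bar L_fh)$, and $L_g\bar L_fh=\frac{\partial(\bar L_fh)}{\partial x}g$. Relative degree two: $L_gh(x,t)=0$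 and $L_g\bar L_fh(x,t)\ne 0$ for all $(x,t)\in\mathcal{D}\times\mathbb{R}_{\ge 0}$. Standing assumptions on the safe set: $\mathcal{C}(t)$ is non-empty with no isolated points, and zero is a regular value of $h$. *)

theory Defs
  imports "HOL-Analysis.Analysis"
begin

text \<open>Functions of state and time are only meaningful on \<open>D \<times> {0..}\<close>, where \<open>D\<close> is an arbitrary
  set of states.  All derivatives are therefore taken relative to this set: for open \<open>D\<close> the
  derivative in \<open>x\<close> is the ordinary one, and the derivative in \<open>t\<close> is one-sided at \<open>t = 0\<close>.\<close>

definition grad_x :: "(real^'n) set \<Rightarrow> (real^'n \<Rightarrow> real \<Rightarrow> real) \<Rightarrow> real^'n \<Rightarrow> real \<Rightarrow> real^'n" where
  "grad_x D h x t = (\<chi> i. frechet_derivative (\<lambda>y. h y t) (at x within D) (axis i 1))"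

definition partial_t :: "(real^'n \<Rightarrow> real \<Rightarrow> real) \<Rightarrow> real^'n \<Rightarrow> real \<Rightarrow> real" where
  "partial_t h x t = vector_derivative (\<lambda>s. h x s) (at t within {0..})"

text \<open>Row vectors are elements of \<open>real^'n\<close> (resp.\ \<open>real^'m\<close>); a row vector times a column vector
  is \<open>\<bullet>\<close>, and a row vector times a matrix is \<open>v*\<close>.\<close>

definition Lie_f ::
  "(real^'n) set \<Rightarrow> (real^'n \<Rightarrow> real^'n) \<Rightarrow> (real^'n \<Rightarrow> real \<Rightarrow> real) \<Rightarrow> real^'n \<Rightarrow> real \<Rightarrow> real" where
  "Lie_f D f h x t = grad_x D h x t \<bullet> f x"

definition Lie_g ::
  "(real^'n) set \<Rightarrow> (real^'n \<Rightarrow> real^'m^'n) \<Rightarrow> (real^'n \<Rightarrow> real \<Rightarrow> real) \<Rightarrow> real^'n \<Rightarrow> real \<Rightarrow> real^'m" where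
  "Lie_g D g h x t = grad_x D h x t v* g x"

definition Lie_bar ::
  "(real^'n) set \<Rightarrow> (real^'n \<Rightarrow> real^'n) \<Rightarrow> (real^'n \<Rightarrow> real \<Rightarrow> real) \<Rightarrow> real^'n \<Rightarrow> real \<Rightarrow> real" where
  "Lie_bar D f h = (\<lambda>x t. partial_t h x t + Lie_f D f h x t)"

definition C2_on :: "'a::real_normed_vector set \<Rightarrow> ('a \<Rightarrow> real) \<Rightarrow> bool" where
  "C2_on S F \<longleftrightarrow>
     (\<exists>(F' :: 'a \<Rightarrow> 'a \<Rightarrow>\<^sub>L real) (F'' :: 'a \<Rightarrow> 'a \<Rightarrow>\<^sub>L 'a \<Rightarrow>\<^sub>L real).
        (\<forall>p\<in>S. (F has_derivative blinfun_apply (F' p)) (at p within S)) \<and>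
        (\<forall>p\<in>S. (F' has_derivative blinfun_apply (F'' p)) (at p within S)) \<and>
        continuous_on S F'')"

definition locally_lipschitz_on :: "'a::metric_space set \<Rightarrow> ('a \<Rightarrow> 'b::metric_space) \<Rightarrow> bool" where
  "locally_lipschitz_on S F \<longleftrightarrow> (\<forall>x\<in>S. \<exists>e>0. \<exists>L. L-lipschitz_on (cball x e \<inter> S) F)"

text \<open>Since \<open>f\<close> is merely locally Lipschitz, \<open>h\<close> being of class \<open>C\<^sup>2\<close> does not make
  \<open>Lie_bar D f h\<close> differentiable.  The first conjunct says that the second-order Lie derivatives
  \<open>(Lie_bar D f ^^ 2) h\<close> and \<open>Lie_g D g (Lie_bar D f h)\<close> exist.\<close>

definition relative_degree_two ::
  "(real^'n) set \<Rightarrow> (real^'n \<Rightarrow> real^'n) \<Rightarrow> (real^'n \<Rightarrow> real^'m^'n) \<Rightarrow> (real^'n \<Rightarrow> real \<Rightarrow> real) \<Rightarrow> bool" where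
  "relative_degree_two D f g h \<longleftrightarrow>
     (\<forall>p \<in> D \<times> {0..}. case_prod (Lie_bar D f h) differentiable (at p within D \<times> {0..})) \<and>
     (\<forall>x\<in>D. \<forall>t\<ge>0. Lie_g D g h x t = 0 \<and> Lie_g D g (Lie_bar D f h) x t \<noteq> 0)"

definition safe_set :: "(real^'n) set \<Rightarrow> (real^'n \<Rightarrow> real \<Rightarrow> real) \<Rightarrow> real \<Rightarrow> (real^'n) set" where
  "safe_set D h t = {x \<in> D. h x t \<ge> 0}"

definition safe_set1 ::
  "(real^'n) set \<Rightarrow> (real^'n \<Rightarrow> real^'n) \<Rightarrow> real \<Rightarrow> (real^'n \<Rightarrow> real \<Rightarrow> real) \<Rightarrow> real \<Rightarrow> (real^'n) set" where
  "safe_set1 D f \<alpha> h t = {x \<in> D. Lie_bar D f h x t + \<alpha> * h x t \<ge> 0}"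

text \<open>The derivative of \<open>h\<close> with respect to \<open>(x, t)\<close> is onto \<open>\<real>\<close>, i.e.\ nonzero, at every zero
  of \<open>h\<close>.\<close>

definition zero_regular_value :: "(real^'n) set \<Rightarrow> (real^'n \<Rightarrow> real \<Rightarrow> real) \<Rightarrow> bool" where
  "zero_regular_value D h \<longleftrightarrow>
     (\<forall>x\<in>D. \<forall>t\<ge>0. h x t = 0 \<longrightarrow> (grad_x D h x t, partial_t h x t) \<noteq> 0)"

definition w_star ::
  "(real^'n) set \<Rightarrow> (real^'n \<Rightarrow> real^'n) \<Rightarrow> (real^'n \<Rightarrow> real^'m^'n) \<Rightarrow> real \<Rightarrow>
   (real^'n \<Rightarrow> real \<Rightarrow> real) \<Rightarrow> real^'n \<Rightarrow> real \<Rightarrow> real^'m \<Rightarrow> real^'m" where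
  "w_star D f g \<theta> h x t u =
     (let l = Lie_g D g (Lie_bar D f h) x t in (- \<theta> * norm u / norm l) *\<^sub>R l)"

definition U_RTVCBF ::
  "(real^'n) set \<Rightarrow> (real^'m) set \<Rightarrow> (real^'n \<Rightarrow> real^'n) \<Rightarrow> (real^'n \<Rightarrow> real^'m^'n) \<Rightarrow>
   real \<Rightarrow> real \<Rightarrow> (real^'n \<Rightarrow> real \<Rightarrow> real) \<Rightarrow> real^'n \<Rightarrow> real \<Rightarrow> (real^'m) set" where
  "U_RTVCBF D U f g \<theta> \<alpha> h x t =
     {u \<in> U. (Lie_bar D f ^^ 2) h x t + 2 * \<alpha> * Lie_bar D f h x t + \<alpha>\<^sup>2 * h x t
              + Lie_g D g (Lie_bar D f h) x t \<bullet> (u + w_star D f g \<theta> h x t u) \<ge> 0}"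

definition sector_nonlinearity ::
  "(real^'m) set \<Rightarrow> real \<Rightarrow> (real^'m \<Rightarrow> real \<Rightarrow> real^'m) \<Rightarrow> bool" where
  "sector_nonlinearity U \<theta> \<phi> \<longleftrightarrow> (\<forall>u\<in>U. \<forall>t\<ge>0. norm (\<phi> u t) \<le> \<theta> * norm u)"

definition closed_loop_solution ::
  "(real^'n) set \<Rightarrow> (real^'n \<Rightarrow> real^'n) \<Rightarrow> (real^'n \<Rightarrow> real^'m^'n) \<Rightarrow>
   (real^'n \<Rightarrow> real^'p \<Rightarrow> real^'m) \<Rightarrow> (real^'m \<Rightarrow> real \<Rightarrow> real^'m) \<Rightarrow> (real \<Rightarrow> real^'p) \<Rightarrow>
   real set \<Rightarrow> (real \<Rightarrow> real^'n) \<Rightarrow> bool" where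
  "closed_loop_solution D f g k \<phi> r J x \<longleftrightarrow>
     (\<forall>t\<in>J. x t \<in> D \<and>
        (let u = k (x t) (r t); w = \<phi> u t
         in (x has_vector_derivative f (x t) + g (x t) *v (u + w)) (at t within J)))"

text \<open>The interval of existence \<open>J\<close> may be all of \<open>{0..}\<close>; shorter intervals cover solutions that
  do not extend to all nonnegative times.\<close>

definition robust_tv_forward_invariant ::
  "(real^'n) set \<Rightarrow> (real^'m) set \<Rightarrow> (real^'p) set \<Rightarrow> (real^'n \<Rightarrow> real^'n) \<Rightarrow>
   (real^'n \<Rightarrow> real^'m^'n) \<Rightarrow> real \<Rightarrow> (real^'n \<Rightarrow> real^'p \<Rightarrow> real^'m) \<Rightarrow>
   (real \<Rightarrow> (real^'n) set) \<Rightarrow> (real^'n) set \<Rightarrow> bool" where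
  "robust_tv_forward_invariant D U R f g \<theta> k C X\<^sub>0 \<longleftrightarrow>
     (\<forall>\<phi> r x J.
        sector_nonlinearity U \<theta> \<phi> \<longrightarrow> (\<forall>t\<ge>0. r t \<in> R) \<longrightarrow>
        is_interval J \<longrightarrow> 0 \<in> J \<longrightarrow> J \<subseteq> {0..} \<longrightarrow>
        closed_loop_solution D f g k \<phi> r J x \<longrightarrow> x 0 \<in> X\<^sub>0 \<longrightarrow>
        (\<forall>t\<in>J. x t \<in> C t))"

end

theory Submission
  imports Defs
begin

text \<open>Along a closed-loop solution, \<open>h\<close> has derivative \<open>Lie_bar D f h\<close>, because the input drops
  out by the relative degree.  Put \<open>y = Lie_bar D f h + \<alpha> h\<close>.  The choice of \<open>w_star\<close> is the worst
  case in the sector by Cauchy--Schwarz, so membership of the control in \<open>U_RTVCBF\<close> gives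
  \<open>y' + \<alpha> y \<ge> 0\<close> for every admissible nonlinearity.  Hence \<open>y\<close> stays nonnegative, which says
  \<open>h' + \<alpha> h \<ge> 0\<close>, and therefore \<open>h\<close> stays nonnegative.\<close>

text \<open>Turns the coordinate vector in the definition of \<open>grad_x\<close> back into the
  linear map it comes from.\<close>

lemma linear_eq_inner_axis:
  fixes A :: "real^'n \<Rightarrow> real"
  assumes "linear A"
  shows "(\<chi> i. A (axis i 1)) \<bullet> v = A v"
proof -
  have "A v = A (\<Sum>i\<in>UNIV. v $ i *\<^sub>R axis i 1)"
    by (simp add: basis_expansion flip: scalar_mult_eq_scaleR)
  also have "\<dots> = (\<Sum>i\<in>UNIV. v $ i * A (axis i 1))"
    by (simp add: linear_sum[OF assms] linear_scale[OF assms])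
  finally show ?thesis
    by (simp add: inner_vec_def mult.commute)
qed

text \<open>Chain rule for relative derivatives: since \<open>c\<close> maps \<open>T\<close> into
  \<open>S\<close>, only the derivative of \<open>F\<close> within \<open>S\<close> matters. It
  serves both for curves and for freezing one argument of a function of state and time.\<close>

lemma has_derivative_along:
  assumes "(F has_derivative F') (at p within S)"
    and "(c has_derivative c') (at q within T)" and "c q = p" and "c ` T \<subseteq> S"
  shows "((\<lambda>s. F (c s)) has_derivative (\<lambda>s. F' (c' s))) (at q within T)"
  using has_derivative_in_compose[OF assms(2)] has_derivative_subset[OF assms(1,4)] assms(3) by simp

text \<open>For general \<open>D\<close> the derivative within \<open>D\<close> is not unique, so \<open>grad_x\<close> depends on an arbitrary
  choice.  All choices agree on the velocity of a curve that stays in \<open>D\<close>.\<close>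

lemma has_real_derivative_along_curve:
  fixes h :: "real^'n \<Rightarrow> real \<Rightarrow> real"
  assumes diff: "case_prod h differentiable (at (x t, t) within D \<times> {0..})"
    and x: "(x has_vector_derivative v) (at t within J)"
    and xD: "x ` J \<subseteq> D" and J: "J \<subseteq> {0..}" "t \<in> J" and nontriv: "at t within J \<noteq> bot"
  shows "((\<lambda>s. h (x s) s) has_real_derivative partial_t h (x t) t + grad_x D h (x t) t \<bullet> v)
           (at t within J)"
proof -
  obtain H where H: "(case_prod h has_derivative H) (at (x t, t) within D \<times> {0..})"
    using diff by (auto simp: differentiable_def)
  then have linH: "linear H"
    by (rule has_derivative_linear)
  have x': "(x has_derivative (\<lambda>s. s *\<^sub>R v)) (at t within J)"
    using x by (simp add: has_vector_derivative_def)
  note H_curve = has_derivative_along[OF H]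
  have curve: "((\<lambda>s. h (x s) s) has_derivative (\<lambda>s. H (s *\<^sub>R v, s))) (at t within J)"
    using H_curve[OF has_derivative_Pair[OF x' has_derivative_ident]] xD J(1) by auto
  have time: "((\<lambda>s. h (x t) s) has_derivative (\<lambda>s. H (0, s))) (at t within {0..})"
    using H_curve[OF has_derivative_Pair[OF has_derivative_const has_derivative_ident]] xD J(2)
    by auto
  have space: "((\<lambda>y. h y t) has_derivative (\<lambda>y. H (y, 0))) (at (x t) within D)"
    using H_curve[OF has_derivative_Pair[OF has_derivative_ident has_derivative_const]] J by auto
  have partial: "partial_t h (x t) t = H (0, 1)"
    unfolding partial_t_def
  proof (rule vector_derivative_within)
    show "at t within {0..} \<noteq> bot"
      using nontriv J(1) at_le[OF J(1), of t] by (auto simp: bot_unique)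
    have "(\<lambda>s. H (0, s)) = (\<lambda>s. s *\<^sub>R H (0, 1))"
    proof
      show "H (0, s) = s *\<^sub>R H (0, 1)" for s
        using linear_scale[OF linH, of s "(0, 1)"] by simp
    qed
    with time show "((\<lambda>s. h (x t) s) has_vector_derivative H (0, 1)) (at t within {0..})"
      by (simp add: has_vector_derivative_def)
  qed
  have tangent: "((\<lambda>s. h (x s) t) has_vector_derivative A v) (at t within J)"
    if A: "((\<lambda>y. h y t) has_derivative A) (at (x t) within D)" for A
  proof -
    have "((\<lambda>s. h (x s) t) has_derivative (\<lambda>s. A (s *\<^sub>R v))) (at t within J)"
      using has_derivative_along[OF A x' refl xD] .
    then show ?thesis
      by (simp add: has_vector_derivative_def linear_scale[OF has_derivative_linear[OF A]])
  qed
  define A where "A = frechet_derivative (\<lambda>y. h y t) (at (x t) within D)"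
  have A: "((\<lambda>y. h y t) has_derivative A) (at (x t) within D)"
    using space frechet_derivative_works differentiable_def unfolding A_def by blast
  have "grad_x D h (x t) t \<bullet> v = A v"
    unfolding grad_x_def A_def[symmetric] by (rule linear_eq_inner_axis[OF has_derivative_linear[OF A]])
  \<comment> \<open>\<open>A\<close> is the derivative chosen by \<open>grad_x\<close>, and
    \<open>H (_, 0)\<close> is another one. Evaluated at \<open>v\<close>, both are the derivative
    of \<open>h (x s) t\<close> in \<open>s\<close> within \<open>J\<close>, which is unique because
    \<open>at t within J\<close> is nontrivial.\<close>
  also have "\<dots> = H (v, 0)"
    by (rule vector_derivative_unique_within[OF nontriv tangent[OF A] tangent[OF space]])
  finally have grad: "grad_x D h (x t) t \<bullet> v = H (v, 0)" .
  have "H (s *\<^sub>R v, s) = (H (0, 1) + H (v, 0)) * s" for s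
    using linear_scale[OF linH, of s "(v, 1)"] linear_add[OF linH, of "(0, 1)" "(v, 0)"]
    by (simp add: mult.commute)
  with curve show ?thesis
    unfolding has_field_derivative_def partial grad by (simp add: fun_eq_iff)
qed

text \<open>The integrating factor \<open>exp (\<alpha> * s)\<close> turns the differential
  inequality into monotonicity of \<open>exp (\<alpha> * s) * y s\<close>.\<close>

lemma exp_growth_nonneg:
  fixes y :: "real \<Rightarrow> real"
  assumes deriv: "\<And>s. s \<in> {0..t} \<Longrightarrow> (y has_real_derivative y' s) (at s within {0..t})"
    and ineq: "\<And>s. s \<in> {0..t} \<Longrightarrow> y' s + \<alpha> * y s \<ge> 0"
    and "y 0 \<ge> 0" "0 \<le> t"
  shows "y t \<ge> 0"
proof -
  define z where "z s = exp (\<alpha> * s) * y s" for s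
  have z: "(z has_real_derivative exp (\<alpha> * s) * (y' s + \<alpha> * y s)) (at s within {0..t})"
    if "s \<in> {0..t}" for s
    unfolding z_def
    by (rule derivative_eq_intros deriv[OF that] refl)+ (simp add: algebra_simps)
  have "z 0 \<le> z t"
  proof (rule DERIV_nonneg_imp_increasing_open[OF \<open>0 \<le> t\<close>])
    fix s assume s: "0 < s" "s < t"
    then show "\<exists>d. DERIV z s :> d \<and> 0 \<le> d"
      using z[of s] ineq[of s] by (auto simp: at_within_Icc_at)
  next
    show "continuous_on {0..t} z"
      using z by (rule DERIV_continuous_on)
  qed
  then have "0 \<le> exp (\<alpha> * t) * y t"
    using \<open>y 0 \<ge> 0\<close> by (simp add: z_def)
  then show ?thesis
    by (simp add: zero_le_mult_iff)
qed

text \<open>\<open>w_star\<close> points against the row vector \<open>l\<close> and has the largest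
  norm that the sector allows. If \<open>l = 0\<close>, both inner products vanish, as division by
  zero gives zero.\<close>

lemma inner_w_star_le:
  assumes "norm w \<le> \<theta> * norm u"
  shows "Lie_g D g (Lie_bar D f h) x t \<bullet> w_star D f g \<theta> h x t u
       \<le> Lie_g D g (Lie_bar D f h) x t \<bullet> w"
proof -
  define l where "l = Lie_g D g (Lie_bar D f h) x t"
  have "l \<bullet> w_star D f g \<theta> h x t u = - (norm l * (\<theta> * norm u))"
    by (simp add: w_star_def Let_def flip: l_def) (simp add: dot_square_norm power2_eq_square)
  also have "\<dots> \<le> - (norm l * norm w)"
    using assms by (simp add: mult_left_mono)
  also have "\<dots> \<le> l \<bullet> w"
    using Cauchy_Schwarz_ineq2[of l w] by linarith
  finally show ?thesis
    by (simp add: l_def)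
qed

lemma inner_grad_x_closed_loop:
  "grad_x D h x t \<bullet> (f x + g x *v u) = Lie_f D f h x t + Lie_g D g h x t \<bullet> u"
  by (simp add: Lie_f_def Lie_g_def inner_add_right dot_lmul_matrix)

theorem theorem1:
  fixes D :: "(real^'n) set" and U :: "(real^'m) set" and R :: "(real^'p) set"
    and f :: "real^'n \<Rightarrow> real^'n" and g :: "real^'n \<Rightarrow> real^'m^'n"
    and h :: "real^'n \<Rightarrow> real \<Rightarrow> real"
    and k :: "real^'n \<Rightarrow> real^'p \<Rightarrow> real^'m"
    and \<theta> \<alpha> :: real
  assumes "0 < \<theta>" "\<theta> < 1" and "\<alpha> > 0"
    and "locally_lipschitz_on D f" and "locally_lipschitz_on D g"
    and "C2_on (D \<times> {0..}) (case_prod h)"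
    and "relative_degree_two D f g h"
    and "\<forall>t\<ge>0. safe_set D h t \<noteq> {} \<and> (\<forall>x. \<not> x isolated_in safe_set D h t)"
    and "zero_regular_value D h"
    and "\<forall>x\<in>D. \<forall>t\<ge>0.
          (SUP u\<in>U. ereal ((Lie_bar D f ^^ 2) h x t
                + Lie_g D g (Lie_bar D f h) x t \<bullet> (u + w_star D f g \<theta> h x t u)))
            \<ge> ereal (- 2 * \<alpha> * Lie_bar D f h x t - \<alpha>\<^sup>2 * h x t)"
    and "\<forall>x\<in>D. \<forall>r\<in>R. k x r \<in> U"
    and "\<exists>L. L-lipschitz_on (D \<times> R) (case_prod k)"
    and "\<forall>x\<in>D. \<forall>r\<in>R. \<forall>t\<ge>0. k x r \<in> U_RTVCBF D U f g \<theta> \<alpha> h x t"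
  shows "robust_tv_forward_invariant D U R f g \<theta> k (safe_set D h)
           (safe_set D h 0 \<inter> safe_set1 D f \<alpha> h 0)"
  unfolding robust_tv_forward_invariant_def
proof (intro allI impI ballI)
  fix \<phi> r x J t
  assume sector: "sector_nonlinearity U \<theta> \<phi>" and r: "\<forall>t\<ge>0. r t \<in> R"
    and J: "is_interval J" "0 \<in> J" "J \<subseteq> {0..}"
    and sol: "closed_loop_solution D f g k \<phi> r J x"
    and x0: "x 0 \<in> safe_set D h 0 \<inter> safe_set1 D f \<alpha> h 0" and t: "t \<in> J"
  have xD: "x s \<in> D" if "s \<in> J" for s
    using sol that by (simp add: closed_loop_solution_def)
  show "x t \<in> safe_set D h t"
  \<comment> \<open>For \<open>t = 0\<close> the interval \<open>{0..t}\<close> is a single point,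
    where derivatives within it carry no information; the claim is then the initial
    condition.\<close>
  proof (cases "t = 0")
    case False
    then have "0 < t"
      using t J(3) by force
    have sub: "{0..t} \<subseteq> J"
      using mem_is_interval_1_I[OF J(1,2) t] by auto
    then have xD': "x ` {0..t} \<subseteq> D"
      using xD by auto
    define u where "u s = k (x s) (r s)" for s
    define w where "w s = \<phi> (u s) s" for s
    have x': "(x has_vector_derivative f (x s) + g (x s) *v (u s + w s)) (at s within {0..t})"
      if "s \<in> {0..t}" for s
    proof (rule has_vector_derivative_within_subset[OF _ sub])
      show "(x has_vector_derivative f (x s) + g (x s) *v (u s + w s)) (at s within J)"
        using sol sub that by (auto simp: closed_loop_solution_def Let_def u_def w_def)
    qed
    \<comment> \<open>Stated for arbitrary \<open>F\<close>, since it is applied to \<open>h\<close>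
      and again to \<open>Lie_bar D f h\<close>.\<close>
    have along: "((\<lambda>s. F (x s) s) has_real_derivative
          Lie_bar D f F (x s) s + Lie_g D g F (x s) s \<bullet> (u s + w s)) (at s within {0..t})"
      if diff: "\<forall>p\<in>D \<times> {0..}. case_prod F differentiable (at p within D \<times> {0..})"
        and s: "s \<in> {0..t}" for F s
    proof -
      have "case_prod F differentiable (at (x s, s) within D \<times> {0..})"
        by (rule diff[rule_format]) (use xD' s in auto)
      from has_real_derivative_along_curve[OF this x'[OF s] xD' _ s] s \<open>0 < t\<close> show ?thesis
        by (simp add: inner_grad_x_closed_loop Lie_bar_def trivial_limit_within islimpt_Icc add.assoc)
    qed
    let ?h1 = "Lie_bar D f h"
    \<comment> \<open>The first fact comes from \<open>C2_on\<close>, the second from the first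
      conjunct of \<open>relative_degree_two\<close>.\<close>
    have diff: "\<forall>p\<in>D \<times> {0..}. case_prod h differentiable (at p within D \<times> {0..})"
      "\<forall>p\<in>D \<times> {0..}. case_prod ?h1 differentiable (at p within D \<times> {0..})"
      using assms(6,7) unfolding C2_on_def relative_degree_two_def differentiable_def by blast+
    have h': "((\<lambda>s. h (x s) s) has_real_derivative ?h1 (x s) s) (at s within {0..t})"
      if "s \<in> {0..t}" for s
    proof -
      have "Lie_g D g h (x s) s = 0"
        using assms(7) sub xD that by (auto simp: relative_degree_two_def)
      then show ?thesis
        using along[OF diff(1) that] by simp
    qed
    \<comment> \<open>Needed at every \<open>s\<close> up to \<open>t\<close>, because it becomes
      the differential inequality for \<open>h\<close>.\<close>
    have y_nonneg: "?h1 (x s) s + \<alpha> * h (x s) s \<ge> 0" if s: "s \<in> {0..t}" for s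
    proof (rule exp_growth_nonneg[where y = "\<lambda>s. ?h1 (x s) s + \<alpha> * h (x s) s"])
      fix q assume "q \<in> {0..s}"
      then have q: "q \<in> {0..t}" "q \<ge> 0" "x q \<in> D" "r q \<in> R"
        using s xD' r by auto
      show "((\<lambda>s. ?h1 (x s) s + \<alpha> * h (x s) s) has_real_derivative
          Lie_bar D f ?h1 (x q) q + Lie_g D g ?h1 (x q) q \<bullet> (u q + w q) + \<alpha> * ?h1 (x q) q)
          (at q within {0..s})"
        using DERIV_add[OF along[OF diff(2) q(1)] DERIV_cmult[OF h'[OF q(1)]]]
        by (rule DERIV_subset) (use s in auto)
      have "u q \<in> U_RTVCBF D U f g \<theta> \<alpha> h (x q) q"
        using assms(13) q by (simp add: u_def)
      moreover from this have "norm (w q) \<le> \<theta> * norm (u q)"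
        using sector q(2) by (auto simp: sector_nonlinearity_def U_RTVCBF_def w_def)
      note inner_w_star_le[OF this, of D g f h "x q" q]
      \<comment> \<open>The left side is the expression defining \<open>U_RTVCBF\<close> with
        \<open>w q\<close> in place of \<open>w_star\<close>, and this replacement can only increase
        it.\<close>
      ultimately show "Lie_bar D f ?h1 (x q) q + Lie_g D g ?h1 (x q) q \<bullet> (u q + w q)
          + \<alpha> * ?h1 (x q) q + \<alpha> * (?h1 (x q) q + \<alpha> * h (x q) q) \<ge> 0"
        by (simp add: U_RTVCBF_def inner_add_right power2_eq_square algebra_simps numeral_2_eq_2)
    qed (use x0 s in \<open>auto simp: safe_set1_def\<close>)
    have "h (x t) t \<ge> 0"
      \<comment> \<open>Same comparison one order lower: \<open>y_nonneg\<close> says that the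
        derivative of \<open>h\<close> along \<open>x\<close> plus \<open>\<alpha>\<close> times
        \<open>h\<close> is nonnegative.\<close>
      by (rule exp_growth_nonneg[OF h' y_nonneg]) (use x0 \<open>0 < t\<close> in \<open>auto simp: safe_set_def\<close>)
    then show ?thesis
      using xD[OF t] by (simp add: safe_set_def)
  qed (use x0 in simp)
qed

end
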